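(* Let $\ell>1$ be an integer and let $\Gamma$ be a connected regular graph that is strongly $\ell$-walk-regular. Then $\Gamma$ has at most four distinct eigenvalues. Moreover, if $\ell$ is even, then $\Gamma$ has at most three distinct eigenvalues and hence $\Gamma$ is either a complete graph or a strongly regular graph.
   Context: Graphs are finite, simple and undirected. For an integer $\ell>1$, a graph $\Gamma$ is strongly $\ell$-walk-regular with parameters $(\lambda_\ell,\mu_\ell,\nu_\ell)$ if the number of walks of length $\ell$ between two vertices is $\lambda_\ell$ for every two adjacent vertices, $\mu_\ell$ for every two distinct non-adjacent vertices, and $\nu_\ell$ for every two identical vertices (i.e. from each vertex to itself). It is strongly $\ell$-walk-regular if this holds for some $\lambda_\ell,\mu_\ell,\nu_\ell$. A strongly regular graph is a regular graph in which the number of common neighbors of two distinct vertices depends only on whether these vertices are adjacent or not. Eigenvalues of a graph are the eigenvalues of its adjacency matrix. *)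

theory Defs
  imports
    "Jordan_Normal_Form.Spectral_Radius"
    "Graph_Theory.Graph_Theory"
begin

text \<open>
  Finite simple undirected graphs are modelled by the locale \<^locale>\<open>graph\<close>: finite
  symmetric digraphs without loops and without parallel arcs. An undirected edge is
  a pair of opposite arcs, so an out-degree is a degree, and an arc walk is determined by its
  start vertex together with the sequence of vertices it visits. The complete graphs are the
  \<^const>\<open>complete_digraph\<close>s.
\<close>

definition num_walks :: "('a, 'b) pre_digraph \<Rightarrow> nat \<Rightarrow> 'a \<Rightarrow> 'a \<Rightarrow> nat" where
  "num_walks G l u v = card {p. pre_digraph.awalk G u p v \<and> length p = l}"

definition strongly_walk_regular_with ::
    "('a, 'b) pre_digraph \<Rightarrow> nat \<Rightarrow> nat \<Rightarrow> nat \<Rightarrow> nat \<Rightarrow> bool" where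
  "strongly_walk_regular_with G l lam mu nu \<longleftrightarrow>
     (\<forall>u \<in> verts G. \<forall>v \<in> verts G.
        (u \<rightarrow>\<^bsub>G\<^esub> v \<longrightarrow> num_walks G l u v = lam) \<and>
        (u \<noteq> v \<and> \<not> u \<rightarrow>\<^bsub>G\<^esub> v \<longrightarrow> num_walks G l u v = mu) \<and>
        (u = v \<longrightarrow> num_walks G l u v = nu))"

definition strongly_walk_regular :: "('a, 'b) pre_digraph \<Rightarrow> nat \<Rightarrow> bool" where
  "strongly_walk_regular G l \<longleftrightarrow> (\<exists>lam mu nu. strongly_walk_regular_with G l lam mu nu)"

definition regular_graph :: "('a, 'b) pre_digraph \<Rightarrow> bool" where
  "regular_graph G \<longleftrightarrow> (\<exists>k. \<forall>v \<in> verts G. out_degree G v = k)"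

definition common_neighbours :: "('a, 'b) pre_digraph \<Rightarrow> 'a \<Rightarrow> 'a \<Rightarrow> 'a set" where
  "common_neighbours G u v = {w \<in> verts G. u \<rightarrow>\<^bsub>G\<^esub> w \<and> v \<rightarrow>\<^bsub>G\<^esub> w}"

text \<open>
  Complete and edgeless graphs are not excluded: for them one of the two conditions is vacuous.
\<close>
definition strongly_regular_graph :: "('a, 'b) pre_digraph \<Rightarrow> bool" where
  "strongly_regular_graph G \<longleftrightarrow>
     regular_graph G \<and>
     (\<exists>a c. \<forall>u \<in> verts G. \<forall>v \<in> verts G. u \<noteq> v \<longrightarrow>
        card (common_neighbours G u v) = (if u \<rightarrow>\<^bsub>G\<^esub> v then a else c))"

text \<open>
  The list \<open>vs\<close> is an enumeration of the vertices and fixes the order of rows and columns;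
  the spectrum does not depend on it. The entries are taken in the complex numbers, so that the
  spectrum consists of all complex eigenvalues.
\<close>
definition adjacency_matrix :: "('a, 'b) pre_digraph \<Rightarrow> 'a list \<Rightarrow> complex mat" where
  "adjacency_matrix G vs =
     Matrix.mat (length vs) (length vs) (\<lambda>(i, j). if (vs ! i) \<rightarrow>\<^bsub>G\<^esub> (vs ! j) then 1 else 0)"

lemma finite_spectrum_adjacency_matrix: "finite (spectrum (adjacency_matrix G vs))"
  by (rule card_finite_spectrum(1)[of _ "length vs"]) (simp add: adjacency_matrix_def)

end

theory Submission
  imports Defs
begin

text \<open>
  Write \<open>T\<close> for the adjacency operator on complex functions on the vertices. Counting
  walks shows that strong \<open>l\<close>-walk-regularity means \<open>T\<^sup>l f = a T f + b f + \<mu> \<Sum>f\<close> for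
  real constants \<open>a\<close> and \<open>b\<close>. An eigenfunction for an eigenvalue other than the valency has sum
  zero, so its eigenvalue is a real root of \<open>x\<^sup>l - a x - b\<close>; by Rolle's theorem
  there are at most three of these, and at most two if \<open>l\<close> is even. In the even case let
  \<open>r\<close> and \<open>s\<close> cover the real roots. Since \<open>T\<close> is self-adjoint, non-real linear factors of
  \<open>x\<^sup>l - a x - b\<close> act injectively and repeated real ones can be dropped, so that
  \<open>(T - r) (T - s)\<close> vanishes on functions of sum zero. Hence its matrix is
  constant, and comparing entries gives the numbers of common neighbours.
\<close>

section \<open>Real roots of trinomials\<close>

text \<open>Points are added in increasing order, and Rolle's theorem between the old maximum and
  the new point supplies one more zero of \<open>f'\<close>. The clause \<open>t < a\<close> keeps
  all earlier zeros below the old maximum, so the new one is distinct from them.\<close>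

lemma Rolle_card:
  fixes f f' :: "real \<Rightarrow> real"
  assumes "finite S" and "\<And>x. x \<in> S \<Longrightarrow> f x = 0"
    and deriv: "\<And>x. (f has_real_derivative f' x) (at x)"
  shows "\<exists>T. finite T \<and> card S \<le> Suc (card T) \<and> (\<forall>t\<in>T. f' t = 0 \<and> (\<exists>a\<in>S. t < a))"
  using assms(1,2)
proof (induction S rule: finite_linorder_max_induct)
  case empty
  show ?case by (intro exI[of _ "{}"]) simp
next
  case (insert b A)
  then obtain T where T: "finite T" "card A \<le> Suc (card T)"
    and T': "\<And>t. t \<in> T \<Longrightarrow> f' t = 0 \<and> (\<exists>a\<in>A. t < a)" by auto
  have b: "b \<notin> A" using insert.hyps by auto
  show ?case
  proof (cases "A = {}")
    case True
    then show ?thesis by (intro exI[of _ "{}"]) simp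
  next
    case False
    define m where "m = Max A"
    have m: "m \<in> A" "\<And>a. a \<in> A \<Longrightarrow> a \<le> m"
      using False insert.hyps(1) by (auto simp: m_def)
    have "m < b" using m insert.hyps by auto
    moreover have "f m = f b" using m insert.prems by simp
    moreover have "continuous_on {m..b} f"
      by (intro continuous_at_imp_continuous_on ballI DERIV_isCont[OF deriv])
    moreover have "f differentiable (at x)" for x
      using deriv real_differentiable_def by blast
    ultimately obtain c where c: "m < c" "c < b" "(f has_real_derivative 0) (at c)"
      using Rolle[of m b f] by blast
    have "f' c = 0" using c(3) deriv DERIV_unique by blast
    moreover have "c \<notin> T" using T' m(2) c(1) by force
    ultimately show ?thesis
      using T T' c(2) b insert.hyps(1) by (intro exI[of _ "insert c T"]) auto
  qed
qed

text \<open>Odd powers are injective on the reals; a positive even power determines its base up to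
  sign.\<close>

lemma card_power_eq_le:
  fixes c :: real
  assumes "finite S" and "m > 0" and S: "\<And>x. x \<in> S \<Longrightarrow> x ^ m = c"
  shows "card S \<le> (if odd m then 1 else 2)"
proof (cases "S = {}")
  case False
  then obtain y where y: "y \<in> S" by blast
  show ?thesis
  proof (cases "odd m")
    case True
    have "x = y" if "x \<in> S" for x
      using S[OF that] S[OF y] odd_real_root_power_cancel[OF True] by metis
    then have "S \<subseteq> {y}" by blast
    then show ?thesis using True card_mono[of "{y}" S] by simp
  next
    case even: False
    have "x = y \<or> x = - y" if "x \<in> S" for x
    proof -
      have "\<bar>x\<bar> ^ m = \<bar>y\<bar> ^ m"
        using S[OF that] S[OF y] even by (simp add: power_even_abs)
      then have "\<bar>x\<bar> = \<bar>y\<bar>" using \<open>m > 0\<close> by (simp add: power_eq_iff_eq_base)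
      then show ?thesis by linarith
    qed
    then have "S \<subseteq> {y, - y}" by blast
    then have "card S \<le> card {y, - y}" by (intro card_mono) simp_all
    also have "\<dots> \<le> 2" by (simp add: card_insert_if)
    finally show ?thesis using even by simp
  qed
qed simp

text \<open>Zeros of the derivative satisfy \<open>t ^ (l - 1) = a / l\<close>, which leaves at most
  one of them for even \<open>l\<close> and two for odd \<open>l\<close>; Rolle's theorem allows one
  root more.\<close>

lemma trinomial_real_roots:
  fixes a b :: real
  assumes "l > 1"
  defines "S \<equiv> {x::real. x ^ l = a * x + b}"
  shows "finite S" and "card S \<le> (if even l then 2 else 3)"
proof -
  \<comment> \<open>Finite subsets come first, since \<open>Rolle_card\<close> needs finiteness; an
    infinite \<open>S\<close> would contain four roots, exceeding either bound.\<close>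
  have *: "card U \<le> (if even l then 2 else 3)" if U: "finite U" "U \<subseteq> S" for U
  proof -
    have "\<exists>T. finite T \<and> card U \<le> Suc (card T) \<and>
        (\<forall>t\<in>T. real l * t ^ (l - 1) - a = 0 \<and> (\<exists>x\<in>U. t < x))"
    proof (rule Rolle_card[where f = "\<lambda>x. x ^ l - a * x - b"])
      show "((\<lambda>x. x ^ l - a * x - b) has_real_derivative real l * x ^ (l - 1) - a) (at x)" for x
        by (auto intro!: derivative_eq_intros)
    qed (use U in \<open>auto simp: S_def\<close>)
    then obtain T where T: "finite T" "card U \<le> Suc (card T)"
      "\<And>t. t \<in> T \<Longrightarrow> real l * t ^ (l - 1) - a = 0" by blast
    have "t ^ (l - 1) = a / real l" if "t \<in> T" for t
      using T(3)[OF that] \<open>l > 1\<close> by (simp add: field_simps)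
    then have "card T \<le> (if odd (l - 1) then 1 else 2)"
      using T(1) \<open>l > 1\<close> by (intro card_power_eq_le) auto
    then show ?thesis using T(2) \<open>l > 1\<close> by (auto split: if_splits)
  qed
  show fin: "finite S"
  proof (rule ccontr)
    assume "infinite S"
    then obtain U where "U \<subseteq> S" "finite U" "card U = 4"
      using infinite_arbitrarily_large by blast
    then show False using *[of U] by (auto split: if_splits)
  qed
  show "card S \<le> (if even l then 2 else 3)" using *[of S] fin by simp
qed

text \<open>The points \<open>r\<close> and \<open>s\<close> may coincide or lie outside
  \<open>S\<close>, so that zero, one and two real roots can be treated alike.\<close>

lemma card_le_2_subset_pair:
  assumes "finite S" and "card S \<le> 2"
  shows "\<exists>r s. S \<subseteq> {r, s}"
proof -
  consider "card S = 0" | "card S = 1" | "card S = 2" using assms(2) by linarith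
  then show ?thesis
    using assms(1) by cases (auto simp: card_1_singleton_iff card_2_iff)
qed

section \<open>The adjacency operator\<close>

text \<open>Acting on functions avoids an enumeration of the vertices. As functions are total,
  vanishing off \<open>verts G\<close> becomes a recurring side condition.\<close>

definition adj_op :: "('a, 'b) pre_digraph \<Rightarrow> ('a \<Rightarrow> complex) \<Rightarrow> 'a \<Rightarrow> complex" where
  "adj_op G f u = (\<Sum>v\<in>verts G. if u \<rightarrow>\<^bsub>G\<^esub> v then f v else 0)"

definition adj_shift ::
    "('a, 'b) pre_digraph \<Rightarrow> complex \<Rightarrow> ('a \<Rightarrow> complex) \<Rightarrow> 'a \<Rightarrow> complex" where
  "adj_shift G z f u = adj_op G f u - z * f u"

text \<open>The polynomial \<open>p\<close> evaluated at the operator; it serves to turn a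
  factorization of \<open>p\<close> into a composition of shifts.\<close>

definition adj_poly ::
    "('a, 'b) pre_digraph \<Rightarrow> complex poly \<Rightarrow> ('a \<Rightarrow> complex) \<Rightarrow> 'a \<Rightarrow> complex" where
  "adj_poly G p f u = (\<Sum>i\<le>degree p. coeff p i * (adj_op G ^^ i) f u)"

section \<open>Linearity, and factorization of polynomials in the operator\<close>

lemma adj_op_diff: "adj_op G (\<lambda>u. f u - g u) = (\<lambda>u. adj_op G f u - adj_op G g u)"
  unfolding adj_op_def fun_eq_iff by (simp flip: sum_subtractf add: if_distrib cong: if_cong)

lemma adj_op_scale: "adj_op G (\<lambda>u. c * f u) = (\<lambda>u. c * adj_op G f u)"
  unfolding adj_op_def fun_eq_iff by (simp add: sum_distrib_left if_distrib cong: if_cong)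

lemma adj_op_sum:
  "adj_op G (\<lambda>u. \<Sum>i\<in>I. c i * g i u) u = (\<Sum>i\<in>I. c i * adj_op G (g i) u)"
proof -
  have "adj_op G (\<lambda>u. \<Sum>i\<in>I. c i * g i u) u =
      (\<Sum>v\<in>verts G. \<Sum>i\<in>I. c i * (if u \<rightarrow>\<^bsub>G\<^esub> v then g i v else 0))"
    unfolding adj_op_def by (intro sum.cong) auto
  also have "\<dots> = (\<Sum>i\<in>I. c i * adj_op G (g i) u)"
    unfolding adj_op_def sum_distrib_left by (rule sum.swap)
  finally show ?thesis .
qed

lemma adj_shift_eq: "adj_shift G z f = (\<lambda>u. adj_op G f u - z * f u)"
  by (simp add: adj_shift_def fun_eq_iff)

text \<open>The expansion is symmetric in \<open>y\<close> and \<open>z\<close>, which is why shifts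
  commute.\<close>

lemma adj_shift_adj_shift:
  "adj_shift G y (adj_shift G z f) u = adj_op G (adj_op G f) u - (y + z) * adj_op G f u + y * z * f u"
  by (simp add: adj_shift_eq adj_op_diff adj_op_scale algebra_simps)

lemma adj_shift_commute: "adj_shift G y (adj_shift G z f) = adj_shift G z (adj_shift G y f)"
  by (rule ext) (simp add: adj_shift_adj_shift algebra_simps)

lemma adj_shift_zero [simp]: "adj_shift G z (\<lambda>_. 0) = (\<lambda>_. 0)"
  by (simp add: adj_shift_def adj_op_def fun_eq_iff)

lemma foldr_adj_shift_commute:
  "foldr (adj_shift G) zs (adj_shift G z f) = adj_shift G z (foldr (adj_shift G) zs f)"
  by (induction zs) (simp_all add: adj_shift_commute[of G z])

text \<open>Multiplying by the indeterminate moves each coefficient up one place, which matches one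
  further application of \<open>adj_op\<close>.\<close>

lemma adj_poly_linear_factor: "adj_poly G ([:- z, 1:] * q) f = adj_shift G z (adj_poly G q f)"
proof (cases "q = 0")
  case True
  then show ?thesis by (simp add: adj_poly_def adj_shift_def adj_op_def fun_eq_iff)
next
  case False
  define n where "n = degree q"
  have deg: "degree ([:- z, 1:] * q) = Suc n"
    using False by (subst degree_mult_eq) (auto simp: n_def)
  have pq: "[:- z, 1:] * q = pCons 0 q - Polynomial.smult z q" by simp
  \<comment> \<open>Both sums below run up to \<open>Suc n\<close>, one beyond the degree of
    \<open>q\<close>; the extra term must vanish.\<close>
  have q0: "coeff q (Suc n) = 0" by (rule coeff_eq_0) (simp add: n_def)
  show ?thesis
  proof
    fix u
    have "adj_poly G ([:- z, 1:] * q) f u =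
        (\<Sum>i\<le>Suc n. coeff (pCons 0 q) i * (adj_op G ^^ i) f u)
          - z * (\<Sum>i\<le>Suc n. coeff q i * (adj_op G ^^ i) f u)"
      unfolding adj_poly_def deg unfolding pq
      by (simp add: sum_subtractf sum_distrib_left algebra_simps del: sum.atMost_Suc)
    also have "(\<Sum>i\<le>Suc n. coeff (pCons 0 q) i * (adj_op G ^^ i) f u) =
        (\<Sum>i\<le>n. coeff q i * adj_op G ((adj_op G ^^ i) f) u)"
      by (subst sum.atMost_Suc_shift) simp
    also have "\<dots> = adj_op G (adj_poly G q f) u"
      unfolding adj_poly_def adj_op_sum n_def ..
    also have "(\<Sum>i\<le>Suc n. coeff q i * (adj_op G ^^ i) f u) = adj_poly G q f u"
      using q0 by (simp add: adj_poly_def n_def)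
    finally show "adj_poly G ([:- z, 1:] * q) f u = adj_shift G z (adj_poly G q f) u"
      by (simp add: adj_shift_def)
  qed
qed

lemma adj_poly_prod_list: "adj_poly G (\<Prod>z\<leftarrow>zs. [:- z, 1:]) f = foldr (adj_shift G) zs f"
proof (induction zs)
  case Nil
  show ?case by (simp add: adj_poly_def fun_eq_iff)
next
  case (Cons z zs)
  then show ?case
    using adj_poly_linear_factor[of G z "\<Prod>z\<leftarrow>zs. [:- z, 1:]" f] by simp
qed

text \<open>The list \<open>zs\<close> holds the complex roots of \<open>x^l - a x - b\<close> with
  multiplicity, given by the fundamental theorem of algebra; the factorization is then evaluated at
  the operator.\<close>

lemma trinomial_splits:
  fixes G :: "('a, 'b) pre_digraph" and a b :: complex
  assumes "l > 1"
  obtains zs where "\<And>z. z \<in> set zs \<Longrightarrow> z ^ l = a * z + b"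
    and "\<And>f u. foldr (adj_shift G) zs f u = (adj_op G ^^ l) f u - a * adj_op G f u - b * f u"
proof -
  define p where "p = monom 1 l - [:b, a:]"
  \<comment> \<open>As \<open>l > 1\<close>, the linear part cannot disturb the leading term, so
    \<open>p\<close> is monic of degree \<open>l\<close>.\<close>
  have small: "degree [:b, a:] < l"
    using assms degree_pCons_le[of b "[:a:]"] by (simp split: if_splits)
  have "degree (monom 1 l + - [:b, a:]) = degree (monom 1 l :: complex poly)"
    by (rule degree_add_eq_left) (simp only: degree_minus degree_monom_eq[OF one_neq_zero] small)
  then have deg: "degree p = l"
    unfolding p_def diff_conv_add_uminus by (simp only: degree_monom_eq[OF one_neq_zero])
  have cf: "coeff p i = (if i = l then 1 else 0) - coeff [:b, a:] i" for i
    by (simp add: p_def)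
  have "coeff p l = 1" using coeff_eq_0[OF small] by (simp add: cf)
  with fundamental_theorem_algebra_factorized[of p] deg
  obtain zs where zs: "(\<Prod>z\<leftarrow>zs. [:- z, 1:]) = p" by auto
  show ?thesis
  proof
    fix z assume "z \<in> set zs"
    then have "[:- z, 1:] dvd p"
      unfolding zs[symmetric] by (intro prod_list_dvd) auto
    then have "poly p z = 0" by (simp add: dvd_iff_poly_eq_0)
    then show "z ^ l = a * z + b" by (simp add: p_def poly_monom algebra_simps)
  next
    fix f :: "'a \<Rightarrow> complex" and u
    let ?X = "\<lambda>i. (adj_op G ^^ i) f u"
    have "foldr (adj_shift G) zs f u = (\<Sum>i\<le>l. coeff p i * ?X i)"
      by (simp add: adj_poly_prod_list[symmetric] zs adj_poly_def deg)
    also have "\<dots> = (\<Sum>i\<le>l. if i = l then ?X i else 0) - (\<Sum>i\<le>l. coeff [:b, a:] i * ?X i)"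
      unfolding sum_subtractf[symmetric] by (intro sum.cong) (auto simp: cf algebra_simps)
    also have "(\<Sum>i\<le>l. coeff [:b, a:] i * ?X i) = (\<Sum>i\<in>{0, 1}. coeff [:b, a:] i * ?X i)"
      using assms by (intro sum.mono_neutral_right)
        (auto simp: coeff_pCons split: nat.splits)
    finally show "foldr (adj_shift G) zs f u = ?X l - a * adj_op G f u - b * f u"
      by simp
  qed
qed

section \<open>Self-adjointness of the operator and cancellation of shifts\<close>

context graph
begin

lemma dominates_sym: "u \<rightarrow>\<^bsub>G\<^esub> v \<longleftrightarrow> v \<rightarrow>\<^bsub>G\<^esub> u"
  using graph_symmetric by blast

lemma not_dominates_self: "\<not> u \<rightarrow>\<^bsub>G\<^esub> u"
  using adj_not_same by blast

text \<open>Injectivity is the absence of parallel arcs; sums over arcs thereby become sums over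
  neighbours.\<close>

lemma bij_betw_head_out_arcs: "bij_betw (head G) (out_arcs G u) {v \<in> verts G. u \<rightarrow>\<^bsub>G\<^esub> v}"
  unfolding bij_betw_def
proof
  show "inj_on (head G) (out_arcs G u)"
    by (rule inj_onI) (auto intro!: no_multi_arcs simp: arc_to_ends_def)
  show "head G ` out_arcs G u = {v \<in> verts G. u \<rightarrow>\<^bsub>G\<^esub> v}"
    by (auto simp: arcs_ends_def arc_to_ends_def image_iff)
qed

text \<open>After exchanging the sums, each \<open>f v\<close> is counted once per neighbour of
  \<open>v\<close>. An eigenfunction for an eigenvalue other than \<open>k\<close> therefore has sum
  zero.\<close>

lemma sum_adj_op:
  assumes "\<And>v. v \<in> verts G \<Longrightarrow> out_degree G v = k"
  shows "(\<Sum>u\<in>verts G. adj_op G f u) = of_nat k * (\<Sum>v\<in>verts G. f v)"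
proof -
  have "card {u \<in> verts G. v \<rightarrow>\<^bsub>G\<^esub> u} = k" if "v \<in> verts G" for v
    using assms[OF that] bij_betw_same_card[OF bij_betw_head_out_arcs]
    by (simp add: out_degree_def)
  then have "(\<Sum>u\<in>verts G. if u \<rightarrow>\<^bsub>G\<^esub> v then f v else 0) = of_nat k * f v" if "v \<in> verts G" for v
    using that by (simp add: dominates_sym[of _ v] sum.If_cases Int_def)
  then show ?thesis
    unfolding adj_op_def by (subst sum.swap) (simp add: sum_distrib_left)
qed

text \<open>The adjacency matrix is real and symmetric.\<close>

lemma adj_op_self_adjoint:
  "(\<Sum>u\<in>verts G. adj_op G f u * cnj (g u)) = (\<Sum>u\<in>verts G. f u * cnj (adj_op G g u))"
proof -
  have "(\<Sum>u\<in>verts G. adj_op G f u * cnj (g u)) =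
      (\<Sum>u\<in>verts G. \<Sum>v\<in>verts G. if u \<rightarrow>\<^bsub>G\<^esub> v then f v * cnj (g u) else 0)"
    unfolding adj_op_def sum_distrib_right by (intro sum.cong) auto
  also have "\<dots> = (\<Sum>v\<in>verts G. \<Sum>u\<in>verts G. if u \<rightarrow>\<^bsub>G\<^esub> v then f v * cnj (g u) else 0)"
    by (rule sum.swap)
  also have "\<dots> = (\<Sum>u\<in>verts G. f u * cnj (adj_op G g u))"
    unfolding adj_op_def cnj_sum sum_distrib_left
    by (intro sum.cong) (auto simp: dominates_sym)
  finally show ?thesis .
qed

lemma sum_cnj_self_eq_0:
  assumes "(\<Sum>u\<in>verts G. f u * cnj (f u)) = (0::complex)" and "u \<in> verts G"
  shows "f u = 0"
proof -
  have "of_real (\<Sum>u\<in>verts G. (cmod (f u))\<^sup>2) = (0::complex)"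
    unfolding of_real_sum complex_norm_square using assms(1) .
  then have "(\<Sum>u\<in>verts G. (cmod (f u))\<^sup>2) = 0" by (simp only: of_real_eq_0_iff)
  then show ?thesis using assms(2) by (simp add: sum_nonneg_eq_0_iff)
qed

text \<open>Self-adjointness gives \<open>z * ?n = cnj z * ?n\<close> for the squared norm
  \<open>?n\<close>, which is nonzero.\<close>

lemma adj_op_eigenvalue_real:
  assumes "\<And>u. u \<in> verts G \<Longrightarrow> adj_op G f u = z * f u" and "u \<in> verts G" "f u \<noteq> 0"
  shows "z \<in> \<real>"
proof -
  let ?n = "\<Sum>u\<in>verts G. f u * cnj (f u)"
  have "z * ?n = (\<Sum>u\<in>verts G. adj_op G f u * cnj (f u))"
    using assms(1) by (simp add: sum_distrib_left mult.assoc)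
  also have "\<dots> = cnj z * ?n"
    unfolding adj_op_self_adjoint using assms(1) by (simp add: sum_distrib_left algebra_simps)
  finally have "z = cnj z" using sum_cnj_self_eq_0[of f u] assms(2,3) by auto
  then show ?thesis by (metis Reals_cnj_iff)
qed

lemma adj_op_off_verts: "u \<notin> verts G \<Longrightarrow> adj_op G f u = 0"
  using adj_in_verts(1) by (auto simp: adj_op_def intro!: sum.neutral)

lemma adj_shift_off_verts:
  "(\<And>u. u \<notin> verts G \<Longrightarrow> f u = 0) \<Longrightarrow> u \<notin> verts G \<Longrightarrow> adj_shift G z f u = 0"
  by (simp add: adj_shift_def adj_op_off_verts)

lemma foldr_adj_shift_off_verts:
  "(\<And>u. u \<notin> verts G \<Longrightarrow> f u = 0) \<Longrightarrow> u \<notin> verts G \<Longrightarrow> foldr (adj_shift G) zs f u = 0"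
  by (induction zs arbitrary: u) (simp_all add: adj_shift_off_verts)

text \<open>A nonzero \<open>f\<close> in the kernel would be an eigenfunction with a non-real
  eigenvalue.\<close>

lemma adj_shift_inj_nonreal:
  assumes "\<And>u. u \<notin> verts G \<Longrightarrow> f u = 0" and "adj_shift G z f = (\<lambda>_. 0)" and "z \<notin> \<real>"
  shows "f = (\<lambda>_. 0)"
proof
  fix u
  have "adj_op G f u = z * f u" for u
    using fun_cong[OF assms(2), of u] by (simp add: adj_shift_def)
  then show "f u = 0" using adj_op_eigenvalue_real[of f z u] assms(1,3) by blast
qed

text \<open>With \<open>g = (T - z) f\<close> and \<open>z\<close> real, self-adjointness moves
  \<open>T - z\<close> across the inner product: \<open><g, g> = <f, (T - z) g> = 0\<close>.\<close>

lemma adj_shift_twice: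
  assumes "\<And>u. u \<notin> verts G \<Longrightarrow> f u = 0"
    and "adj_shift G z (adj_shift G z f) = (\<lambda>_. 0)" and "z \<in> \<real>"
  shows "adj_shift G z f = (\<lambda>_. 0)"
proof
  fix u
  define g where "g = adj_shift G z f"
  have g: "adj_op G g v = z * g v" for v
    using fun_cong[OF assms(2), of v] by (simp add: adj_shift_def g_def)
  have cnjz: "cnj z = z" using assms(3) by (simp add: Reals_cnj_iff)
  have "(\<Sum>v\<in>verts G. g v * cnj (g v)) =
      (\<Sum>v\<in>verts G. adj_op G f v * cnj (g v)) - (\<Sum>v\<in>verts G. f v * cnj (z * g v))"
    by (simp add: g_def adj_shift_def algebra_simps sum_subtractf cnjz)
  also have "\<dots> = 0" by (simp add: adj_op_self_adjoint g)
  finally have zero: "(\<Sum>v\<in>verts G. g v * cnj (g v)) = 0" .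
  show "adj_shift G z f u = 0"
  proof (cases "u \<in> verts G")
    case True
    from sum_cnj_self_eq_0[OF zero this] show ?thesis unfolding g_def .
  next
    case False
    with assms(1) show ?thesis by (rule adj_shift_off_verts)
  qed
qed

text \<open>Induction over the factors: a non-real one is cancelled by injectivity, and a real one
  repeats \<open>r\<close> or \<open>s\<close>, so it is absorbed by
  \<open>adj_shift_twice\<close>.\<close>

lemma foldr_adj_shift_eq_0:
  assumes "\<And>u. u \<notin> verts G \<Longrightarrow> f u = 0"
    and "foldr (adj_shift G) zs f = (\<lambda>_. 0)"
    and "set zs \<inter> \<real> \<subseteq> {r, s}"
  shows "adj_shift G r (adj_shift G s f) = (\<lambda>_. 0)"
  using assms
proof (induction zs arbitrary: f)
  case Nil
  then have "f = (\<lambda>_. 0)" by simp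
  then show ?case by simp
next
  case (Cons z zs)
  have sub: "set zs \<inter> \<real> \<subseteq> {r, s}" using Cons.prems(3) by auto
  note off = adj_shift_off_verts[of f, OF Cons.prems(1)]
  show ?case
  proof (cases "z \<in> \<real>")
    case False
    have "foldr (adj_shift G) zs f = (\<lambda>_. 0)"
      using adj_shift_inj_nonreal[OF foldr_adj_shift_off_verts[of f _ zs, OF Cons.prems(1)]]
        Cons.prems(2) False by simp
    then show ?thesis using Cons.IH[of f, OF Cons.prems(1) _ sub] by simp
  next
    case True
    then have z: "z = r \<or> z = s" using Cons.prems(3) by auto
    \<comment> \<open>The head factor is commuted to the innermost place, so that the induction
      hypothesis applies to \<open>(T - z) f\<close>.\<close>
    have "adj_shift G r (adj_shift G s (adj_shift G z f)) = (\<lambda>_. 0)"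
      using Cons.IH[of "adj_shift G z f", OF off _ sub] Cons.prems(2)
      by (simp add: foldr_adj_shift_commute)
    \<comment> \<open>The conditional selects the partner of \<open>z\<close> in the pair; the case
      \<open>r = s\<close> is included.\<close>
    then have dbl: "adj_shift G z (adj_shift G z (adj_shift G (if z = r then s else r) f)) = (\<lambda>_. 0)"
      using z by (auto simp: adj_shift_commute split: if_splits)
    have "adj_shift G z (adj_shift G (if z = r then s else r) f) = (\<lambda>_. 0)"
      using adj_shift_twice[OF _ dbl True] off by blast
    then show ?thesis using z by (auto simp: adj_shift_commute split: if_splits)
  qed
qed

section \<open>Walks and eigenvalues\<close>

lemma finite_awalks_length: "finite {p. awalk u p v \<and> length p = n}"
  by (rule finite_subset[OF _ finite_lists_length_eq[OF finite_arcs, of n]]) auto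

text \<open>Walks are split by their first arc, and different first arcs give disjoint sets.\<close>

lemma num_walks_Suc:
  "num_walks G (Suc n) u v = (\<Sum>w | w \<in> verts G \<and> u \<rightarrow>\<^bsub>G\<^esub> w. num_walks G n w v)"
proof -
  let ?W = "\<lambda>w. {p. awalk w p v \<and> length p = n}"
  have "{p. awalk u p v \<and> length p = Suc n} = (\<Union>e\<in>out_arcs G u. (#) e ` ?W (head G e))"
    by (auto simp: length_Suc_conv awalk_Cons_iff)
  then have "num_walks G (Suc n) u v = card (\<Union>e\<in>out_arcs G u. (#) e ` ?W (head G e))"
    by (simp add: num_walks_def)
  also have "\<dots> = (\<Sum>e\<in>out_arcs G u. card ((#) e ` ?W (head G e)))"
    by (intro card_UN_disjoint) (auto simp: finite_awalks_length)
  also have "\<dots> = (\<Sum>e\<in>out_arcs G u. num_walks G n (head G e) v)"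
    by (simp add: card_image num_walks_def)
  also have "\<dots> = (\<Sum>w | w \<in> verts G \<and> u \<rightarrow>\<^bsub>G\<^esub> w. num_walks G n w v)"
    by (rule sum.reindex_bij_betw[OF bij_betw_head_out_arcs])
  finally show ?thesis .
qed

lemma num_walks_0: "num_walks G 0 u v = (if u = v \<and> u \<in> verts G then 1 else 0)"
proof -
  have *: "{p. awalk u p v \<and> length p = 0} = (if u = v \<and> u \<in> verts G then {[]} else {})"
    by (auto simp: awalk_Nil_iff)
  show ?thesis unfolding num_walks_def * by auto
qed

text \<open>Walk counts are the entries of the powers of the adjacency matrix.\<close>

lemma adj_op_power_num_walks:
  "u \<in> verts G \<Longrightarrow> (adj_op G ^^ n) f u = (\<Sum>v\<in>verts G. of_nat (num_walks G n u v) * f v)"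
proof (induction n arbitrary: u)
  case 0
  have "(\<Sum>v\<in>verts G. of_nat (num_walks G 0 u v) * f v) = (\<Sum>v\<in>verts G. if v = u then f v else 0)"
    by (intro sum.cong) (auto simp: num_walks_0)
  then show ?case using 0 by simp
next
  case (Suc n)
  have "(adj_op G ^^ Suc n) f u =
      (\<Sum>w | w \<in> verts G \<and> u \<rightarrow>\<^bsub>G\<^esub> w. (adj_op G ^^ n) f w)"
    by (simp add: adj_op_def sum.inter_filter)
  also have "\<dots> = (\<Sum>w | w \<in> verts G \<and> u \<rightarrow>\<^bsub>G\<^esub> w. \<Sum>v\<in>verts G. of_nat (num_walks G n w v) * f v)"
    by (intro sum.cong) (auto simp: Suc.IH)
  also have "\<dots> = (\<Sum>v\<in>verts G. of_nat (num_walks G (Suc n) u v) * f v)"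
    by (subst sum.swap) (simp add: num_walks_Suc sum_distrib_right)
  finally show ?case .
qed

text \<open>In matrix form \<open>A^l = lam A + mu (J - I - A) + nu I\<close>, and the all-ones
  matrix \<open>J\<close> annihilates functions of sum zero. Hence \<open>a = lam - mu\<close> and
  \<open>b = nu - mu\<close>, with subtraction taken in the reals.\<close>

lemma strongly_walk_regular_adj_op:
  assumes "strongly_walk_regular G l"
  obtains a b :: real where "\<And>f u. \<lbrakk>(\<Sum>v\<in>verts G. f v) = 0; u \<in> verts G\<rbrakk> \<Longrightarrow>
    (adj_op G ^^ l) f u = of_real a * adj_op G f u + of_real b * f u"
proof -
  obtain lam mu nu where swr: "strongly_walk_regular_with G l lam mu nu"
    using assms by (auto simp: strongly_walk_regular_def)
  show ?thesis
  proof
    fix f :: "'a \<Rightarrow> complex" and u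
    assume f: "(\<Sum>v\<in>verts G. f v) = 0" and u: "u \<in> verts G"
    have "of_nat (num_walks G l u v) * f v =
        of_real (real lam - real mu) * (if u \<rightarrow>\<^bsub>G\<^esub> v then f v else 0)
        + of_real (real nu - real mu) * (if v = u then f v else 0) + of_nat mu * f v"
      if "v \<in> verts G" for v
      using swr u that not_dominates_self[of u]
      by (auto simp: strongly_walk_regular_with_def algebra_simps)
    then have "(adj_op G ^^ l) f u =
        (\<Sum>v\<in>verts G. of_real (real lam - real mu) * (if u \<rightarrow>\<^bsub>G\<^esub> v then f v else 0)
        + of_real (real nu - real mu) * (if v = u then f v else 0) + of_nat mu * f v)"
      using u by (simp add: adj_op_power_num_walks)
    also have "\<dots> = of_real (real lam - real mu) * adj_op G f u
        + of_real (real nu - real mu) * f u + of_nat mu * (\<Sum>v\<in>verts G. f v)"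
      using u by (simp only: sum.distrib sum_distrib_left[symmetric] adj_op_def
          sum.delta' sum.delta finite_verts if_True)
    finally show "(adj_op G ^^ l) f u = of_real (real lam - real mu) * adj_op G f u
        + of_real (real nu - real mu) * f u"
      using f by simp
  qed
qed

text \<open>An eigenvector is carried over to the vertices along the enumeration \<open>vs\<close>
  and extended by zero.\<close>

lemma spectrum_adjacency_matrixE:
  assumes "z \<in> spectrum (adjacency_matrix G vs)" and "distinct vs" "set vs = verts G"
  obtains f u where "u \<in> verts G" "f u \<noteq> 0"
    and "\<And>u. u \<notin> verts G \<Longrightarrow> f u = 0" and "adj_op G f = (\<lambda>u. z * f u)"
proof -
  define n where "n = length vs"
  have bij: "bij_betw ((!) vs) {..<n} (verts G)"
    using assms by (intro bij_betw_nth) (auto simp: n_def)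
  obtain x where x: "x \<in> carrier_vec n" "x \<noteq> 0\<^sub>v n"
      "adjacency_matrix G vs *\<^sub>v x = z \<cdot>\<^sub>v x"
    using assms(1)
    by (auto simp: spectrum_def eigenvalue_def eigenvector_def adjacency_matrix_def n_def)
  define f where "f u = (if u \<in> verts G then x $ the_inv_into {..<n} ((!) vs) u else 0)" for u
  have f: "f (vs ! i) = x $ i" if "i < n" for i
    using that bij the_inv_into_f_f[of "(!) vs" "{..<n}" i]
    by (auto simp: f_def bij_betw_def)
  have "adj_op G f u = z * f u" for u
  proof (cases "u \<in> verts G")
    case True
    then obtain i where i: "i < n" "u = vs ! i" using bij by (auto simp: bij_betw_def)
    have "adj_op G f u = (\<Sum>j<n. if u \<rightarrow>\<^bsub>G\<^esub> (vs ! j) then f (vs ! j) else 0)"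
      unfolding adj_op_def by (rule sum.reindex_bij_betw[OF bij, symmetric])
    also have "\<dots> = (\<Sum>j<n. (if u \<rightarrow>\<^bsub>G\<^esub> (vs ! j) then 1 else 0) * x $ j)"
      by (intro sum.cong) (auto simp: f)
    also have "\<dots> = (adjacency_matrix G vs *\<^sub>v x) $ i"
      using i x(1) by (simp add: adjacency_matrix_def n_def scalar_prod_def lessThan_atLeast0)
    also have "\<dots> = z * f u" using i x by (simp add: f)
    finally show ?thesis .
  qed (simp add: adj_op_off_verts f_def)
  moreover obtain i where "i < n" "x $ i \<noteq> 0"
    using x by (metis carrier_vecD eq_vecI index_zero_vec)
  then have "vs ! i \<in> verts G" "f (vs ! i) \<noteq> 0"
    using bij f by (auto simp: bij_betw_def)
  ultimately show ?thesis using that[of "vs ! i" f] by (auto simp: f_def)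
qed

text \<open>Every eigenvalue is the valency \<open>k\<close> or a real root of the
  trinomial.\<close>

lemma card_spectrum_le:
  assumes "regular_graph G" and "distinct vs" "set vs = verts G" and "l > 1"
    and swr: "\<And>f u. \<lbrakk>(\<Sum>v\<in>verts G. f v) = 0; u \<in> verts G\<rbrakk> \<Longrightarrow>
      (adj_op G ^^ l) f u = of_real a * adj_op G f u + of_real b * f u"
  shows "card (spectrum (adjacency_matrix G vs)) \<le> (if even l then 3 else 4)"
proof -
  obtain k where k: "\<And>v. v \<in> verts G \<Longrightarrow> out_degree G v = k"
    using assms(1) by (auto simp: regular_graph_def)
  define S where "S = {x::real. x ^ l = a * x + b}"
  have S: "finite S" "card S \<le> (if even l then 2 else 3)"
    using trinomial_real_roots[OF assms(4)] by (auto simp: S_def)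
  have "z \<in> insert (of_nat k) (of_real ` S)" if "z \<in> spectrum (adjacency_matrix G vs)" for z
  proof -
    from that assms(2,3) obtain f u where u: "u \<in> verts G" "f u \<noteq> 0"
      and f: "adj_op G f = (\<lambda>u. z * f u)"
      by (rule spectrum_adjacency_matrixE)
    from adj_op_eigenvalue_real[of f z u] u f obtain x where x: "z = of_real x"
      by (auto elim: Reals_cases)
    have pow: "(adj_op G ^^ n) f = (\<lambda>u. z ^ n * f u)" for n
    proof (induction n)
      case (Suc n)
      then show ?case by (simp add: adj_op_scale f) (simp add: mult_ac)
    qed simp
    \<comment> \<open>The eigenvalue equation is summed over all vertices.\<close>
    have "z * (\<Sum>v\<in>verts G. f v) = of_nat k * (\<Sum>v\<in>verts G. f v)"
      using sum_adj_op[OF k, of f] by (simp add: f sum_distrib_left)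
    then consider "z = of_nat k" | "(\<Sum>v\<in>verts G. f v) = 0" by auto
    then show ?thesis
    proof cases
      case 2
      have "z ^ l * f u = (of_real a * z + of_real b) * f u"
        using swr[OF 2 u(1)] by (simp add: pow f algebra_simps)
      then have "complex_of_real (x ^ l) = of_real (a * x + b)" using u(2) x by simp
      then have "x \<in> S" unfolding S_def by (simp only: of_real_eq_iff mem_Collect_eq)
      then show ?thesis using x by simp
    qed simp
  qed
  then have "spectrum (adjacency_matrix G vs) \<subseteq> insert (of_nat k) (of_real ` S)" by blast
  then have "card (spectrum (adjacency_matrix G vs)) \<le> card (insert (of_nat k) (of_real ` S :: complex set))"
    using S(1) by (intro card_mono) auto
  also have "\<dots> \<le> Suc (card S)"
    using S(1) card_image_le[of S complex_of_real] by (simp add: card_insert_if)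
  finally show ?thesis using S(2) by (auto split: if_splits)
qed

section \<open>Strong regularity\<close>

text \<open>Column \<open>v\<close> of \<open>A^2 - (r + s) A + r s I\<close>; by symmetry, the
  entries of \<open>A^2\<close> count common neighbours.\<close>

lemma adj_shift_indicator:
  assumes "v \<in> verts G"
  shows "adj_shift G r (adj_shift G s (\<lambda>w. if w = v then 1 else 0)) u =
    of_nat (card (common_neighbours G u v)) - (r + s) * (if u \<rightarrow>\<^bsub>G\<^esub> v then 1 else 0)
      + r * s * (if u = v then 1 else 0)"
proof -
  let ?e = "\<lambda>w. if w = v then 1 else (0::complex)"
  have T: "adj_op G ?e = (\<lambda>w. if w \<rightarrow>\<^bsub>G\<^esub> v then 1 else 0)"
  proof
    fix w
    have "adj_op G ?e w = (\<Sum>x\<in>verts G. if x = v then (if w \<rightarrow>\<^bsub>G\<^esub> v then 1 else 0) else 0)"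
      unfolding adj_op_def by (intro sum.cong) auto
    then show "adj_op G ?e w = (if w \<rightarrow>\<^bsub>G\<^esub> v then 1 else 0)" using assms by simp
  qed
  have "adj_op G (adj_op G ?e) u = (\<Sum>w\<in>verts G. if u \<rightarrow>\<^bsub>G\<^esub> w \<and> v \<rightarrow>\<^bsub>G\<^esub> w then 1 else 0)"
    unfolding T unfolding adj_op_def by (intro sum.cong) (auto simp: dominates_sym)
  also have "\<dots> = of_nat (card (common_neighbours G u v))"
    by (simp add: common_neighbours_def sum.If_cases Int_def)
  finally have TT: "adj_op G (adj_op G ?e) u = of_nat (card (common_neighbours G u v))" .
  have "adj_shift G r (adj_shift G s ?e) u =
      adj_op G (adj_op G ?e) u - (r + s) * adj_op G ?e u + r * s * ?e u"
    by (rule adj_shift_adj_shift)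
  then show ?thesis unfolding TT unfolding T .
qed

text \<open>Differences of two indicators have sum zero, so each row of the matrix \<open>m\<close>
  of \<open>(T - r) (T - s)\<close> is constant; by symmetry the whole matrix is.\<close>

lemma strongly_regular_graph_if_adj_shift_eq_0:
  assumes "regular_graph G"
    and vanish: "\<And>f. \<lbrakk>\<And>u. u \<notin> verts G \<Longrightarrow> f u = 0; (\<Sum>v\<in>verts G. f v) = 0\<rbrakk> \<Longrightarrow>
      adj_shift G r (adj_shift G s f) = (\<lambda>_. 0)"
  shows "strongly_regular_graph G"
proof -
  let ?e = "\<lambda>v w. if w = v then 1 else (0::complex)"
  define m where "m u v = adj_shift G r (adj_shift G s (?e v)) u" for u v
  have m: "m u v = of_nat (card (common_neighbours G u v))
      - (r + s) * (if u \<rightarrow>\<^bsub>G\<^esub> v then 1 else 0) + r * s * (if u = v then 1 else 0)"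
    if "v \<in> verts G" for u v
    unfolding m_def using that by (rule adj_shift_indicator)
  have "common_neighbours G u v = common_neighbours G v u" for u v
    by (auto simp: common_neighbours_def)
  then have m_sym: "m u v = m v u" if "u \<in> verts G" "v \<in> verts G" for u v
    using that dominates_sym[of u v] by (auto simp: m)
  have m_right: "m u v = m u w" if "v \<in> verts G" "w \<in> verts G" for u v w
  proof -
    have "adj_shift G r (adj_shift G s (\<lambda>x. ?e v x - ?e w x)) = (\<lambda>_. 0)"
      using that by (intro vanish) (auto simp: sum_subtractf)
    then have "adj_shift G r (adj_shift G s (\<lambda>x. ?e v x - ?e w x)) u = 0" by simp
    then show ?thesis
      unfolding m_def adj_shift_adj_shift adj_op_diff by (simp add: algebra_simps)
  qed
  obtain c where c: "\<And>u v. \<lbrakk>u \<in> verts G; v \<in> verts G\<rbrakk> \<Longrightarrow> m u v = c"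
  proof (cases "verts G = {}")
    case True
    then show ?thesis by (intro that[of 0]) simp
  next
    case False
    then obtain w where w: "w \<in> verts G" by blast
    have "m u v = m w w" if "u \<in> verts G" "v \<in> verts G" for u v
      using m_right[OF that(2) w, of u] m_sym[OF that(1) w] m_right[OF that(1) w, of w] by simp
    then show ?thesis using that by blast
  qed
  \<comment> \<open>The definition asks for natural parameters while \<open>c\<close>,
    \<open>r\<close> and \<open>s\<close> are complex. Rounding is exact whenever the relevant kind
    of pair occurs, and gives an arbitrary value otherwise.\<close>
  have "card (common_neighbours G u v) =
      (if u \<rightarrow>\<^bsub>G\<^esub> v then nat \<lfloor>Re (c + (r + s))\<rfloor> else nat \<lfloor>Re c\<rfloor>)"
    if "u \<in> verts G" "v \<in> verts G" "u \<noteq> v" for u v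
  proof -
    have "of_nat (card (common_neighbours G u v)) = c + (r + s) * (if u \<rightarrow>\<^bsub>G\<^esub> v then 1 else 0)"
      using c[OF that(1,2)] m[OF that(2), of u] that(3)
      by (auto simp: algebra_simps)
    from arg_cong[OF this, of Re] have
      "real (card (common_neighbours G u v)) = (if u \<rightarrow>\<^bsub>G\<^esub> v then Re (c + (r + s)) else Re c)"
      by simp
    then show ?thesis by (metis floor_of_nat nat_int)
  qed
  then show ?thesis
    unfolding strongly_regular_graph_def using assms(1) by blast
qed

end

theorem theorem3p4:
  fixes G :: "('a, 'b) pre_digraph" and l :: nat and vs :: "'a list"
  assumes "graph G"
    and "Digraph_Component.connected G"
    and "regular_graph G"
    and "l > 1"
    and "strongly_walk_regular G l"
    and "distinct vs" and "set vs = verts G"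
  shows "card (spectrum (adjacency_matrix G vs)) \<le> 4 \<and>
    (even l \<longrightarrow>
       card (spectrum (adjacency_matrix G vs)) \<le> 3 \<and>
       (complete_digraph (card (verts G)) G \<or> strongly_regular_graph G))"
proof -
  interpret graph G by fact
  obtain a b :: real where swr: "\<And>f u. \<lbrakk>(\<Sum>v\<in>verts G. f v) = 0; u \<in> verts G\<rbrakk> \<Longrightarrow>
      (adj_op G ^^ l) f u = of_real a * adj_op G f u + of_real b * f u"
    using strongly_walk_regular_adj_op[OF assms(5)] by blast
  have card: "card (spectrum (adjacency_matrix G vs)) \<le> (if even l then 3 else 4)"
    using assms(3,6,7,4) swr by (rule card_spectrum_le)
  \<comment> \<open>This includes complete graphs, which the definition of strong regularity
    admits.\<close>
  have "strongly_regular_graph G" if even: "even l"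
  proof -
    obtain r s :: real where rs: "{x::real. x ^ l = a * x + b} \<subseteq> {r, s}"
      using card_le_2_subset_pair[OF trinomial_real_roots(1)[OF assms(4), of a b]]
        trinomial_real_roots(2)[OF assms(4), of a b] even by auto
    obtain zs where zs: "\<And>z. z \<in> set zs \<Longrightarrow> z ^ l = complex_of_real a * z + of_real b"
      and split: "\<And>f u. foldr (adj_shift G) zs f u =
        (adj_op G ^^ l) f u - of_real a * adj_op G f u - of_real b * f u"
      by (rule trinomial_splits[OF assms(4), where G = G and a = "of_real a" and b = "of_real b"])
        blast
    \<comment> \<open>As \<open>a\<close> and \<open>b\<close> are real, a root in \<open>zs\<close>
      that is real solves the real trinomial.\<close>
    have real_roots: "set zs \<inter> \<real> \<subseteq> {of_real r, of_real s}"
    proof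
      fix z assume "z \<in> set zs \<inter> \<real>"
      then obtain x where x: "z = of_real x" "z \<in> set zs" by (auto elim: Reals_cases)
      then have "complex_of_real (x ^ l) = of_real (a * x + b)" using zs[of z] by simp
      then have "x ^ l = a * x + b" by (simp only: of_real_eq_iff)
      then show "z \<in> {of_real r, of_real s}" using rs x by auto
    qed
    show ?thesis
    proof (rule strongly_regular_graph_if_adj_shift_eq_0[OF assms(3)])
      fix f :: "'a \<Rightarrow> complex"
      assume off: "\<And>u. u \<notin> verts G \<Longrightarrow> f u = 0" and sum0: "(\<Sum>v\<in>verts G. f v) = 0"
      \<comment> \<open>At vertices this is walk-regularity on functions of sum zero; elsewhere the
        support condition persists under shifts.\<close>
      have "foldr (adj_shift G) zs f u = 0" for u
        using foldr_adj_shift_off_verts[of f u zs] off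
        by (cases "u \<in> verts G") (auto simp: split swr[OF sum0])
      then have "foldr (adj_shift G) zs f = (\<lambda>_. 0)" by blast
      then show "adj_shift G (of_real r) (adj_shift G (of_real s) f) = (\<lambda>_. 0)"
        using off real_roots by (intro foldr_adj_shift_eq_0[where zs = zs]) auto
    qed
  qed
  then show ?thesis using card by (auto split: if_splits)
qed

end
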